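(* Let $G$ be a non-Hausdorff ample groupoid. Then $J\cap\mathcal{C}_c(G)=\{0\}$ if and only if $J_{\mathbb{C}}=\{0\}$.
   Context: Groupoids. A groupoid $G$ is a small category all of whose morphisms are invertible, identified with its set of morphisms; $G^{(0)}\subseteq G$ is its set of units, $r,s\colon G\to G^{(0)}$ are range and source, and $G_x=s^{-1}(x)$. Topological groupoids (continuous range, source, multiplication, inversion) are always assumed locally compact with $G^{(0)}$ Hausdorff in the subspace topology; $G$ itself need not be Hausdorff, and compact subsets need not be closed. $G$ is étale if $r$ is a local homeomorphism, and ample if in addition $G^{(0)}$ is totally disconnected. An open bisection is an open subset $U\subseteq G$ on which $r$ and $s$ are injective ($U$ is then locally compact Hausdorff). $C^*$-algebra. For an open bisection $U$, $C_c(U)$ is the set of continuous functions $U\to\mathbb{C}$ with compact support in $U$, extended by zero to functions on $G$; $\mathcal{C}_c(G)$ is the linear span of all $C_c(U)$, a $*$-algebra under $f^*(g)=\overline{f(g^{-1})}$ and convolution $(f_1*f_2)(g)=\sum_{g_1g_2=g}f_1(g_1)f_2(g_2)$. For $x\in G^{(0)}$, $\pi_x\colon\mathcal{C}_c(G)\to\mathcal{L}(\ell^2(G_x))$ is $\pi_x(f)\xi=f*\xi$; $C^*_r(G)$ is the completion of $\mathcal{C}_c(G)$ in the norm $\sup_{x}\|\pi_x(f)\|$. Elements $f\in C^*_r(G)$ are viewed as functions on $G$ via $f(g)=\langle\pi_{s(g)}(f)\delta_{s(g)},\delta_g\rangle$. Steinberg algebra. $\mathbb{C}G$ is the span of the functions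 $c_U\colon G\to\mathbb{C}$ ($c\in\mathbb{C}$, $U\subseteq G$ compact open bisection), where $c_U$ equals $c$ on $U$ and $0$ elsewhere. Singular ideals. With $\mathrm{supp}^\circ(f)=\{g: f(g)\neq0\}$, set $J=\{f\in C^*_r(G): s(\mathrm{supp}^\circ(f))\text{ has empty interior}\}$ and $J_{\mathbb{C}}=\{f\in\mathbb{C}G:\mathrm{supp}^\circ(f)\text{ has empty interior}\}$. *)

theory Defs
  imports "HOL-Analysis.Analysis" "HOL-Library.Function_Algebras"
begin

section \<open>Topological groupoids\<close>

text \<open>
  The set of morphisms is \<open>topspace (gtop G)\<close>; the operations are only meaningful on it, and
  \<open>mul G g h\<close> only when \<open>src G g = rng G h\<close>.
\<close>

record 'g groupoid =
  gtop :: "'g topology"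
  rng :: "'g \<Rightarrow> 'g"
  src :: "'g \<Rightarrow> 'g"
  mul :: "'g \<Rightarrow> 'g \<Rightarrow> 'g"
  ginv :: "'g \<Rightarrow> 'g"

abbreviation arrows :: "'g groupoid \<Rightarrow> 'g set"
  where "arrows G \<equiv> topspace (gtop G)"

definition units :: "'g groupoid \<Rightarrow> 'g set"
  where "units G = src G ` arrows G"

definition src_fibre :: "'g groupoid \<Rightarrow> 'g \<Rightarrow> 'g set"
  where "src_fibre G x = {g \<in> arrows G. src G g = x}"

definition composable :: "'g groupoid \<Rightarrow> ('g \<times> 'g) set"
  where "composable G = {(g, h). g \<in> arrows G \<and> h \<in> arrows G \<and> src G g = rng G h}"

definition units_top :: "'g groupoid \<Rightarrow> 'g topology"
  where "units_top G = subtopology (gtop G) (units G)"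

locale groupoid =
  fixes G :: "'g groupoid"
  assumes rng_closed: "g \<in> arrows G \<Longrightarrow> rng G g \<in> arrows G"
    and src_closed: "g \<in> arrows G \<Longrightarrow> src G g \<in> arrows G"
    and rng_rng: "g \<in> arrows G \<Longrightarrow> rng G (rng G g) = rng G g"
    and src_rng: "g \<in> arrows G \<Longrightarrow> src G (rng G g) = rng G g"
    and rng_src: "g \<in> arrows G \<Longrightarrow> rng G (src G g) = src G g"
    and src_src: "g \<in> arrows G \<Longrightarrow> src G (src G g) = src G g"
    and mul_closed: "(g, h) \<in> composable G \<Longrightarrow> mul G g h \<in> arrows G"
    and rng_mul: "(g, h) \<in> composable G \<Longrightarrow> rng G (mul G g h) = rng G g"
    and src_mul: "(g, h) \<in> composable G \<Longrightarrow> src G (mul G g h) = src G h"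
    and mul_assoc: "(g, h) \<in> composable G \<Longrightarrow> (h, k) \<in> composable G \<Longrightarrow>
           mul G (mul G g h) k = mul G g (mul G h k)"
    and mul_rng: "g \<in> arrows G \<Longrightarrow> mul G (rng G g) g = g"
    and mul_src: "g \<in> arrows G \<Longrightarrow> mul G g (src G g) = g"
    and inv_closed: "g \<in> arrows G \<Longrightarrow> ginv G g \<in> arrows G"
    and rng_inv: "g \<in> arrows G \<Longrightarrow> rng G (ginv G g) = src G g"
    and src_inv: "g \<in> arrows G \<Longrightarrow> src G (ginv G g) = rng G g"
    and inv_mul: "g \<in> arrows G \<Longrightarrow> mul G (ginv G g) g = src G g"
    and mul_inv: "g \<in> arrows G \<Longrightarrow> mul G g (ginv G g) = rng G g"

locale topological_groupoid = groupoid G for G :: "'g groupoid" +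
  assumes continuous_rng: "continuous_map (gtop G) (gtop G) (rng G)"
    and continuous_src: "continuous_map (gtop G) (gtop G) (src G)"
    and continuous_mul: "continuous_map
          (subtopology (prod_topology (gtop G) (gtop G)) (composable G))
          (gtop G) (\<lambda>(g, h). mul G g h)"
    and continuous_inv: "continuous_map (gtop G) (gtop G) (ginv G)"
    and locally_compact: "locally_compact_space (gtop G)"
    and Hausdorff_units: "Hausdorff_space (units_top G)"

definition local_homeomorphism :: "'a topology \<Rightarrow> 'b topology \<Rightarrow> ('a \<Rightarrow> 'b) \<Rightarrow> bool"
  where "local_homeomorphism X Y f \<longleftrightarrow>
    f ` topspace X \<subseteq> topspace Y \<and>
    (\<forall>x \<in> topspace X. \<exists>U. openin X U \<and> x \<in> U \<and> openin Y (f ` U) \<and>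
       homeomorphic_map (subtopology X U) (subtopology Y (f ` U)) f)"

definition totally_disconnected_space :: "'a topology \<Rightarrow> bool"
  where "totally_disconnected_space X \<longleftrightarrow> (\<forall>S. connectedin X S \<longrightarrow> (\<exists>a. S \<subseteq> {a}))"

locale etale_groupoid = topological_groupoid G for G :: "'g groupoid" +
  assumes local_homeomorphism_rng: "local_homeomorphism (gtop G) (units_top G) (rng G)"

locale ample_groupoid = etale_groupoid G for G :: "'g groupoid" +
  assumes totally_disconnected_units: "totally_disconnected_space (units_top G)"

definition open_bisection :: "'g groupoid \<Rightarrow> 'g set \<Rightarrow> bool"
  where "open_bisection G U \<longleftrightarrow>
    openin (gtop G) U \<and> inj_on (rng G) U \<and> inj_on (src G) U"


section \<open>The convolution algebra and the Steinberg algebra\<close>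

text \<open>Functions on \<open>G\<close> are represented by functions on the type that vanish off \<open>arrows G\<close>.\<close>

definition supp_open :: "('g \<Rightarrow> complex) \<Rightarrow> 'g set"
  where "supp_open f = {g. f g \<noteq> 0}"

text \<open>
  The support is closed up inside \<open>U\<close>, and not in \<open>G\<close>, where the closure of a compact set
  need not be compact.
\<close>

definition Cc_on :: "'g groupoid \<Rightarrow> 'g set \<Rightarrow> ('g \<Rightarrow> complex) set"
  where "Cc_on G U = {f.
    continuous_map (subtopology (gtop G) U) euclidean f \<and>
    compactin (subtopology (gtop G) U)
      (subtopology (gtop G) U closure_of (U \<inter> supp_open f)) \<and>
    (\<forall>g. g \<notin> U \<longrightarrow> f g = 0)}"

abbreviation complex_span :: "('g \<Rightarrow> complex) set \<Rightarrow> ('g \<Rightarrow> complex) set"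
  where "complex_span \<equiv> module.span (\<lambda>(c::complex) f g. c * f g)"

definition Cc :: "'g groupoid \<Rightarrow> ('g \<Rightarrow> complex) set"
  where "Cc G = complex_span (\<Union>U \<in> {U. open_bisection G U}. Cc_on G U)"

definition steinberg_algebra :: "'g groupoid \<Rightarrow> ('g \<Rightarrow> complex) set"
  where "steinberg_algebra G = complex_span
    {(\<lambda>g. if g \<in> U then c else 0) | c U. open_bisection G U \<and> compactin (gtop G) U}"

definition convolution :: "'g groupoid \<Rightarrow> ('g \<Rightarrow> complex) \<Rightarrow> ('g \<Rightarrow> complex) \<Rightarrow> 'g \<Rightarrow> complex"
  where "convolution G f1 f2 g =
    (\<Sum>\<^sub>\<infinity>(g1, g2) \<in> {(g1, g2) \<in> composable G. mul G g1 g2 = g}. f1 g1 * f2 g2)"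


section \<open>The reduced C*-algebra\<close>

text \<open>
  \<open>\<ell>\<^sup>2(A)\<close> consists of functions on the whole type vanishing off \<open>A\<close>, and operators on it of
  functions that are \<open>0\<close> off \<open>ell2 A\<close>, so that equality of functions is equality of operators.
\<close>

definition ell2 :: "'a set \<Rightarrow> ('a \<Rightarrow> complex) set"
  where "ell2 A = {\<xi>. (\<lambda>a. (cmod (\<xi> a))\<^sup>2) summable_on UNIV \<and> (\<forall>a. a \<notin> A \<longrightarrow> \<xi> a = 0)}"

definition ell2_inner :: "('a \<Rightarrow> complex) \<Rightarrow> ('a \<Rightarrow> complex) \<Rightarrow> complex"
  where "ell2_inner \<xi> \<eta> = (\<Sum>\<^sub>\<infinity>a. \<xi> a * cnj (\<eta> a))"

definition ell2_norm :: "('a \<Rightarrow> complex) \<Rightarrow> real"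
  where "ell2_norm \<xi> = sqrt (\<Sum>\<^sub>\<infinity>a. (cmod (\<xi> a))\<^sup>2)"

definition delta :: "'a \<Rightarrow> 'a \<Rightarrow> complex"
  where "delta a = (\<lambda>b. if b = a then 1 else 0)"

definition bounded_operators :: "'a set \<Rightarrow> (('a \<Rightarrow> complex) \<Rightarrow> 'a \<Rightarrow> complex) set"
  where "bounded_operators A = {T.
    (\<forall>\<xi> \<in> ell2 A. T \<xi> \<in> ell2 A) \<and>
    (\<forall>\<xi> \<in> ell2 A. \<forall>\<eta> \<in> ell2 A. T (\<xi> + \<eta>) = T \<xi> + T \<eta>) \<and>
    (\<forall>c. \<forall>\<xi> \<in> ell2 A. T (\<lambda>a. c * \<xi> a) = (\<lambda>a. c * T \<xi> a)) \<and>
    (\<exists>B. \<forall>\<xi> \<in> ell2 A. ell2_norm (T \<xi>) \<le> B * ell2_norm \<xi>) \<and>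
    (\<forall>\<xi>. \<xi> \<notin> ell2 A \<longrightarrow> T \<xi> = 0)}"

definition operator_norm :: "'a set \<Rightarrow> (('a \<Rightarrow> complex) \<Rightarrow> 'a \<Rightarrow> complex) \<Rightarrow> real"
  where "operator_norm A T = (SUP \<xi> \<in> {\<xi> \<in> ell2 A. ell2_norm \<xi> \<le> 1}. ell2_norm (T \<xi>))"

type_synonym 'g operator_family = "'g \<Rightarrow> ('g \<Rightarrow> complex) \<Rightarrow> 'g \<Rightarrow> complex"

text \<open>
  The \<open>\<ell>\<^sup>\<infinity>\<close>-product of the algebras of bounded operators on \<open>\<ell>\<^sup>2(G\<^sub>x)\<close>, for units \<open>x\<close>.
\<close>

definition bounded_families :: "'g groupoid \<Rightarrow> 'g operator_family set"
  where "bounded_families G = {T.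
    (\<forall>x \<in> units G. T x \<in> bounded_operators (src_fibre G x)) \<and>
    bdd_above ((\<lambda>x. operator_norm (src_fibre G x) (T x)) ` units G) \<and>
    (\<forall>x. x \<notin> units G \<longrightarrow> T x = 0)}"

definition family_norm :: "'g groupoid \<Rightarrow> 'g operator_family \<Rightarrow> real"
  where "family_norm G T = (SUP x \<in> units G. operator_norm (src_fibre G x) (T x))"

text \<open>\<open>regular_rep G f\<close> is the family \<open>(\<pi>\<^sub>x(f))\<^sub>x\<close>.\<close>

definition regular_rep :: "'g groupoid \<Rightarrow> ('g \<Rightarrow> complex) \<Rightarrow> 'g operator_family"
  where "regular_rep G f x \<xi> =
    (if x \<in> units G \<and> \<xi> \<in> ell2 (src_fibre G x) then convolution G f \<xi> else 0)"

text \<open>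
  By definition of the reduced norm, \<open>regular_rep G\<close> is isometric from \<open>Cc G\<close> into the Banach
  space \<open>bounded_families G\<close>, so the completion of \<open>Cc G\<close> is the closure of its image there.
  The component at \<open>x\<close> of an element of the closure is its image under the extension of
  \<open>\<pi>\<^sub>x\<close> to the completion.
\<close>

definition reduced_algebra :: "'g groupoid \<Rightarrow> 'g operator_family set"
  where "reduced_algebra G = {T \<in> bounded_families G.
    \<forall>\<epsilon>>0. \<exists>f \<in> Cc G. family_norm G (T - regular_rep G f) < \<epsilon>}"

definition as_function :: "'g groupoid \<Rightarrow> 'g operator_family \<Rightarrow> 'g \<Rightarrow> complex"
  where "as_function G T g =
    (if g \<in> arrows G then ell2_inner (T (src G g) (delta (src G g))) (delta g) else 0)"


section \<open>Singular ideals\<close>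

definition singular_ideal :: "'g groupoid \<Rightarrow> 'g operator_family set"
  where "singular_ideal G = {T \<in> reduced_algebra G.
    units_top G interior_of (src G ` supp_open (as_function G T)) = {}}"

definition steinberg_singular_ideal :: "'g groupoid \<Rightarrow> ('g \<Rightarrow> complex) set"
  where "steinberg_singular_ideal G = {f \<in> steinberg_algebra G.
    gtop G interior_of (supp_open f) = {}}"

end

theory Submission
  imports Defs
begin

text \<open>
  If a Steinberg function \<open>f\<close> is singular, then its support is cut into finitely many pieces by the
  bisections occurring in \<open>f\<close>, each of which the source map sends onto a difference of two open
  sets. If \<open>s(supp f)\<close> had interior, one piece would have interior, and so would \<open>supp f\<close>.
  Hence \<open>f \<in> J\<close>.

  Conversely, let \<open>f = \<Sum>\<^sub>i f\<^sub>i \<in> J\<close> with \<open>f\<^sub>i \<in> C\<^sub>c(U\<^sub>i)\<close> and \<open>f(g) \<noteq> 0\<close>. Over a small compact open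
  neighbourhood \<open>W\<close> of \<open>s(g)\<close> replace each \<open>f\<^sub>i\<close> by its value over \<open>s(g)\<close>. The sums of these values
  over subsets of the index set take finitely many values, so such a sum that is close to \<open>0\<close> vanishes.
  Therefore the resulting Steinberg function vanishes wherever \<open>f\<close> does, and it is singular but
  nonzero at \<open>g\<close>.
\<close>

section \<open>Open maps and totally disconnected spaces\<close>

text \<open>Openness of the image is checked near each of its points: on the chart \<open>V\<close>
  the map is a homeomorphism onto an open set, so \<open>V \<inter> U\<close> already has open image
  in \<open>Y\<close>.\<close>

lemma local_homeomorphism_imp_open_map:
  assumes "local_homeomorphism X Y f"
  shows "open_map X Y f"
  unfolding open_map_def
proof (intro allI impI)
  fix U assume U: "openin X U"
  show "openin Y (f ` U)"
  proof (subst openin_subopen, intro ballI)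
    fix y assume "y \<in> f ` U"
    then obtain x where x: "x \<in> U" "y = f x" by blast
    then have "x \<in> topspace X" using U openin_subset by blast
    then obtain V where V: "openin X V" "x \<in> V" "openin Y (f ` V)"
      "homeomorphic_map (subtopology X V) (subtopology Y (f ` V)) f"
      using assms unfolding local_homeomorphism_def by blast
    have "openin (subtopology X V) (V \<inter> U)"
      using U by (simp add: openin_subtopology_Int2)
    then have "openin (subtopology Y (f ` V)) (f ` (V \<inter> U))"
      using homeomorphic_imp_open_map[OF V(4)] unfolding open_map_def by blast
    then have "openin Y (f ` (V \<inter> U))"
      using V(3) openin_trans_full by blast
    then show "\<exists>T. openin Y T \<and> y \<in> T \<and> T \<subseteq> f ` U"
      using x V(2) by blast
  qed
qed

text \<open>Total disconnectedness makes \<open>{x}\<close> a connected component. In a locally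
  compact Hausdorff space a compact component can be separated by a clopen set from the complement
  of an open \<open>U\<close> lying in a compact \<open>K\<close>. That clopen set lies in
  \<open>K\<close> and is therefore compact.\<close>

lemma compact_open_neighbourhood:
  assumes lc: "locally_compact_space X" and H: "Hausdorff_space X"
    and td: "totally_disconnected_space X" and V: "openin X V" and x: "x \<in> V"
  obtains W where "openin X W" "compactin X W" "x \<in> W" "W \<subseteq> V"
proof -
  have xX: "x \<in> topspace X" using V x openin_subset by blast
  have "neighbourhood_base_of (\<lambda>C. compactin X C \<and> closedin X C) X"
    using lc H locally_compact_space_neighbourhood_base_closedin by blast
  then obtain U K where U: "openin X U" "x \<in> U" "U \<subseteq> K" "compactin X K" "K \<subseteq> V"
    using V x unfolding neighbourhood_base_of by meson
  obtain a where "connected_component_of_set X x \<subseteq> {a}"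
    using td connectedin_connected_component_of[of X x]
    unfolding totally_disconnected_space_def by meson
  moreover have "x \<in> connected_component_of_set X x"
    using xX by (simp add: connected_component_of_refl)
  ultimately have sing: "connected_component_of_set X x = {x}"
    by blast
  have "separated_between X {x} (topspace X - U)"
  proof (rule separated_between_compact_connected_component[OF lc H])
    show "{x} \<in> connected_components_of X"
      using sing xX by (metis connected_component_in_connected_components_of)
  qed (use xX U in \<open>auto simp: disjnt_def\<close>)
  then obtain A B where AB: "openin X A" "openin X B" "A \<union> B = topspace X" "disjnt A B"
      "{x} \<subseteq> A" "topspace X - U \<subseteq> B"
    unfolding separated_between_def by blast
  have "A = topspace X - B"
    using AB openin_subset by (fastforce simp: disjnt_def)
  then have "closedin X A" using AB by blast
  moreover have "A \<subseteq> U" using AB openin_subset[OF AB(1)] by (auto simp: disjnt_def)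
  ultimately have "compactin X A" using U closed_compactin by (metis order_trans)
  then show thesis using that[of A] AB \<open>A \<subseteq> U\<close> U by blast
qed

text \<open>A difference of two open sets is nowhere dense unless it has interior, and finitely many
  nowhere dense sets cannot cover a nonempty open set. In the induction, the open set
  \<open>V \<inter> P\<close> either is empty, or lies in \<open>P - Q\<close>, or meets
  \<open>Q\<close> in an open set that misses \<open>P - Q\<close> and is covered by the remaining
  sets.\<close>

lemma finite_Union_open_Diff_open_interior:
  assumes "finite \<F>" "\<And>A. A \<in> \<F> \<Longrightarrow> \<exists>P Q. openin X P \<and> openin X Q \<and> A = P - Q"
    and "openin X V" "V \<noteq> {}" "V \<subseteq> \<Union>\<F>"
  shows "\<exists>A \<in> \<F>. \<exists>V'. openin X V' \<and> V' \<noteq> {} \<and> V' \<subseteq> A"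
  using assms
proof (induction \<F> arbitrary: V rule: finite_induct)
  case empty
  then show ?case by simp
next
  case (insert A \<F>)
  obtain P Q where PQ: "openin X P" "openin X Q" "A = P - Q"
    using insert.prems(1)[of A] by auto
  have IH: "\<exists>A \<in> \<F>. \<exists>V'. openin X V' \<and> V' \<noteq> {} \<and> V' \<subseteq> A"
    if "openin X V'" "V' \<noteq> {}" "V' \<subseteq> \<Union>\<F>" for V'
    using insert.IH[OF _ that] insert.prems(1) by simp
  consider "V \<inter> P = {}" | "V \<inter> P \<inter> Q \<noteq> {}" | "V \<inter> P \<noteq> {}" "V \<inter> P \<inter> Q = {}"
    by blast
  then show ?case
  proof cases
    case 1
    then have "V \<subseteq> \<Union>\<F>" using insert.prems(4) PQ(3) by auto
    then show ?thesis using IH insert.prems(2,3) by simp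
  next
    case 2
    have "openin X (V \<inter> P \<inter> Q)" using insert.prems(2) PQ by blast
    moreover have "V \<inter> P \<inter> Q \<subseteq> \<Union>\<F>" using insert.prems(4) PQ by auto
    ultimately show ?thesis using IH[OF _ 2] by simp
  next
    case 3
    have "openin X (V \<inter> P)" using insert.prems(2) PQ by blast
    moreover have "V \<inter> P \<subseteq> A" using 3 PQ by auto
    ultimately show ?thesis using 3 by blast
  qed
qed

section \<open>Groupoids and open bisections\<close>

context groupoid
begin

lemma inv_inv:
  assumes g: "g \<in> arrows G"
  shows "ginv G (ginv G g) = g"
proof -
  let ?h = "ginv G g" let ?k = "ginv G ?h"
  have a: "?h \<in> arrows G" "?k \<in> arrows G" using g inv_closed by auto
  have c: "(?k, ?h) \<in> composable G" "(?h, g) \<in> composable G"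
    using a g by (auto simp: composable_def rng_inv src_inv)
  have "?k = mul G ?k (mul G ?h g)"
    using a g by (metis inv_mul mul_src src_inv rng_inv)
  also have "\<dots> = mul G (mul G ?k ?h) g" using mul_assoc[OF c] by simp
  also have "\<dots> = g" using a g by (metis inv_mul mul_rng src_inv)
  finally show ?thesis .
qed

lemma units_subset: "units G \<subseteq> arrows G"
  using src_closed by (auto simp: units_def)

lemma src_in_units: "g \<in> arrows G \<Longrightarrow> src G g \<in> units G"
  by (simp add: units_def)

lemma topspace_units_top [simp]: "topspace (units_top G) = units G"
  using units_subset by (auto simp: units_top_def)

lemma mul_inv_cancel:
  assumes "(k, g) \<in> composable G"
  shows "mul G (ginv G k) (mul G k g) = g"
proof -
  have k: "k \<in> arrows G" "g \<in> arrows G" "src G k = rng G g" using assms by (auto simp: composable_def)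
  then have "(ginv G k, k) \<in> composable G" by (auto simp: composable_def inv_closed src_inv)
  then have "mul G (ginv G k) (mul G k g) = mul G (mul G (ginv G k) k) g"
    using mul_assoc assms by simp
  then show ?thesis using k by (simp add: inv_mul mul_rng)
qed

lemma mul_cancel_inv:
  assumes "k \<in> arrows G" "g \<in> arrows G" "rng G k = rng G g"
  shows "(k, mul G (ginv G k) g) \<in> composable G" "mul G k (mul G (ginv G k) g) = g"
proof -
  have c: "(ginv G k, g) \<in> composable G"
    using assms by (auto simp: composable_def inv_closed src_inv)
  show "(k, mul G (ginv G k) g) \<in> composable G"
    using c assms mul_closed[OF c] rng_mul[OF c] by (simp add: composable_def rng_inv)
  show "mul G k (mul G (ginv G k) g) = g"
    using mul_inv_cancel[OF c] assms(1) by (simp add: inv_inv)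
qed

end

section \<open>Openness of the source map and compact open bisections\<close>

context etale_groupoid
begin

lemma open_map_rng: "open_map (gtop G) (units_top G) (rng G)"
  using local_homeomorphism_imp_open_map local_homeomorphism_rng by blast

lemma open_map_inv: "open_map (gtop G) (gtop G) (ginv G)"
proof -
  have "homeomorphic_maps (gtop G) (gtop G) (ginv G) (ginv G)"
    by (auto simp: homeomorphic_maps_def continuous_inv inv_inv)
  then show ?thesis using homeomorphic_maps_imp_map homeomorphic_imp_open_map by blast
qed

text \<open>Etaleness is stated for the range. It passes to the source because \<open>src\<close> is
  \<open>rng\<close> after inversion, and inversion is a homeomorphism, being continuous and its own
  inverse.\<close>

lemma open_map_src: "open_map (gtop G) (units_top G) (src G)"
  unfolding open_map_def
proof (intro allI impI)
  fix U assume U: "openin (gtop G) U"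
  have "src G g = rng G (ginv G g)" if "g \<in> U" for g
    using that U openin_subset rng_inv by (metis subsetD)
  then have "src G ` U = rng G ` ginv G ` U" by (auto simp: image_image)
  then show "openin (units_top G) (src G ` U)"
    using open_map_inv open_map_rng U unfolding open_map_def by metis
qed

lemma continuous_src_units: "continuous_map (gtop G) (units_top G) (src G)"
  using continuous_src src_in_units unfolding units_top_def
  by (auto simp: continuous_map_in_subtopology)

lemma locally_compact_units: "locally_compact_space (units_top G)"
proof (rule locally_compact_space_continuous_open_map_image[OF continuous_src_units open_map_src])
  show "src G ` arrows G = topspace (units_top G)" by (simp add: units_def)
qed (rule locally_compact)

lemma open_bisection_homeomorphic_src:
  assumes "open_bisection G U"
  shows "homeomorphic_map (subtopology (gtop G) U) (subtopology (units_top G) (src G ` U)) (src G)"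
proof (rule bijective_open_imp_homeomorphic_map)
  have U: "openin (gtop G) U" "inj_on (src G) U" using assms by (auto simp: open_bisection_def)
  have sub: "U \<subseteq> arrows G" using U openin_subset by blast
  show "continuous_map (subtopology (gtop G) U) (subtopology (units_top G) (src G ` U)) (src G)"
    using continuous_src_units by (simp add: continuous_map_in_subtopology continuous_map_from_subtopology)
  show "open_map (subtopology (gtop G) U) (subtopology (units_top G) (src G ` U)) (src G)"
    unfolding open_map_def
  proof (intro allI impI)
    fix V assume "openin (subtopology (gtop G) U) V"
    then have V: "openin (gtop G) V" "V \<subseteq> U" using U by (auto simp: openin_open_subtopology)
    then have "openin (units_top G) (src G ` V)" using open_map_src by (simp add: open_map_def)
    then show "openin (subtopology (units_top G) (src G ` U)) (src G ` V)"
      using V by (intro iffD2[OF openin_subtopology] exI[of _ "src G ` V"]) auto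
  qed
  show "src G ` topspace (subtopology (gtop G) U) = topspace (subtopology (units_top G) (src G ` U))"
    using sub src_in_units by auto
  show "inj_on (src G) (topspace (subtopology (gtop G) U))"
    using U sub by (simp add: inf_absorb2)
qed

text \<open>The source map carries \<open>A\<close> homeomorphically onto \<open>W\<close>, so
  compactness of \<open>W\<close> lifts to \<open>A\<close>. This supplies the compact open
  bisections from which Steinberg functions are built.\<close>

lemma open_bisection_restrict_src:
  assumes U: "open_bisection G U" and W: "openin (units_top G) W" "compactin (units_top G) W"
    "W \<subseteq> src G ` U"
  defines "A \<equiv> {g \<in> U. src G g \<in> W}"
  shows "open_bisection G A" "compactin (gtop G) A"
proof -
  have sub: "U \<subseteq> arrows G" and o: "openin (gtop G) U"
    using U openin_subset by (auto simp: open_bisection_def)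
  have "A = U \<inter> {g \<in> arrows G. src G g \<in> W}" using sub A_def by auto
  moreover have "openin (gtop G) {g \<in> arrows G. src G g \<in> W}"
    using continuous_src_units W by (auto simp: continuous_map_def)
  ultimately have "openin (gtop G) A" using o by auto
  then show "open_bisection G A"
    using U by (auto simp: open_bisection_def A_def inj_on_def)
  have img: "src G ` A = W" using W by (auto simp: A_def)
  have "compactin (subtopology (units_top G) (src G ` U)) (src G ` A)"
    using W img by (simp add: compactin_subtopology)
  then have "compactin (subtopology (gtop G) U) A"
    using homeomorphic_map_compactness[OF open_bisection_homeomorphic_src[OF U], of A] sub
    by (auto simp: A_def)
  then show "compactin (gtop G) A" by (simp add: compactin_subtopology)
qed

end

section \<open>Square-summable functions\<close>

text \<open>Provides closure and induction rules for the spans that define \<open>Cc\<close> and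
  \<open>steinberg_algebra\<close>.\<close>

interpretation fun_module: module "\<lambda>(c::complex) (f::'a \<Rightarrow> complex) g. c * f g"
  by unfold_locales (auto simp: fun_eq_iff algebra_simps)

lemma summable_on_finite_support:
  fixes f :: "'a \<Rightarrow> 'b::{comm_monoid_add, topological_space}"
  assumes "finite {a \<in> A. f a \<noteq> 0}"
  shows "f summable_on A"
proof -
  have "f summable_on A \<longleftrightarrow> f summable_on {a \<in> A. f a \<noteq> 0}"
    by (rule summable_on_cong_neutral) auto
  then show ?thesis using assms by simp
qed

lemma infsum_single_support:
  fixes f :: "'a \<Rightarrow> 'b::{comm_monoid_add, t2_space}"
  assumes "a \<in> A" "\<And>b. b \<in> A \<Longrightarrow> b \<noteq> a \<Longrightarrow> f b = 0"
  shows "infsum f A = f a"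
proof -
  have "infsum f A = infsum f {a}"
    by (rule infsum_cong_neutral) (use assms in auto)
  then show ?thesis by simp
qed

lemma ell2_norm_sq: "(ell2_norm \<xi>)\<^sup>2 = (\<Sum>\<^sub>\<infinity>a. (cmod (\<xi> a))\<^sup>2)"
  unfolding ell2_norm_def by (simp add: infsum_nonneg)

lemma ell2_norm_nonneg: "ell2_norm \<xi> \<ge> 0"
  unfolding ell2_norm_def by (simp add: infsum_nonneg)

lemma ell2_zero [simp]: "0 \<in> ell2 A"
  by (simp add: ell2_def)

lemma ell2_norm_zero [simp]: "ell2_norm 0 = 0"
  by (simp add: ell2_norm_def)

lemma ell2_scale:
  assumes "\<xi> \<in> ell2 A"
  shows "(\<lambda>a. c * \<xi> a) \<in> ell2 A"
    and "(ell2_norm (\<lambda>a. c * \<xi> a))\<^sup>2 = (cmod c)\<^sup>2 * (ell2_norm \<xi>)\<^sup>2"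
  using assms unfolding ell2_norm_sq
  by (auto simp: ell2_def norm_mult power_mult_distrib infsum_cmult_right'
      intro!: summable_on_cmult_right)

lemma cmod_add_sq_le: "(cmod (a + b))\<^sup>2 \<le> 2 * (cmod a)\<^sup>2 + 2 * (cmod b)\<^sup>2"
proof -
  have "(cmod (a + b))\<^sup>2 \<le> (cmod a + cmod b)\<^sup>2"
    by (simp add: norm_triangle_ineq power_mono)
  also have "\<dots> \<le> 2 * (cmod a)\<^sup>2 + 2 * (cmod b)\<^sup>2"
    using sum_squares_bound[of "cmod a" "cmod b"] by (simp add: power2_sum)
  finally show ?thesis .
qed

text \<open>Both parts follow pointwise from \<open>cmod_add_sq_le\<close>. The constant 2 is
  harmless, since the estimate serves only to show that operators are bounded.\<close>

lemma ell2_add: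
  assumes "\<xi> \<in> ell2 A" "\<eta> \<in> ell2 A"
  shows "\<xi> + \<eta> \<in> ell2 A"
    and "(ell2_norm (\<xi> + \<eta>))\<^sup>2 \<le> 2 * (ell2_norm \<xi>)\<^sup>2 + 2 * (ell2_norm \<eta>)\<^sup>2"
proof -
  have s: "(\<lambda>a. 2 * (cmod (\<xi> a))\<^sup>2) summable_on UNIV" "(\<lambda>a. 2 * (cmod (\<eta> a))\<^sup>2) summable_on UNIV"
    using assms by (auto simp: ell2_def intro!: summable_on_cmult_right)
  have s2: "(\<lambda>a. 2 * (cmod (\<xi> a))\<^sup>2 + 2 * (cmod (\<eta> a))\<^sup>2) summable_on UNIV"
    using s by (rule summable_on_add)
  have s3: "(\<lambda>a. (cmod ((\<xi> + \<eta>) a))\<^sup>2) summable_on UNIV"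
    by (rule summable_on_comparison_test[OF s2]) (auto simp: cmod_add_sq_le)
  then show "\<xi> + \<eta> \<in> ell2 A" using assms by (auto simp: ell2_def)
  have "(ell2_norm (\<xi> + \<eta>))\<^sup>2 \<le> (\<Sum>\<^sub>\<infinity>a. 2 * (cmod (\<xi> a))\<^sup>2 + 2 * (cmod (\<eta> a))\<^sup>2)"
    unfolding ell2_norm_sq by (rule infsum_mono[OF s3 s2]) (auto simp: cmod_add_sq_le)
  also have "\<dots> = 2 * (ell2_norm \<xi>)\<^sup>2 + 2 * (ell2_norm \<eta>)\<^sup>2"
    unfolding ell2_norm_sq infsum_add[OF s] by (simp add: infsum_cmult_right')
  finally show "(ell2_norm (\<xi> + \<eta>))\<^sup>2 \<le> 2 * (ell2_norm \<xi>)\<^sup>2 + 2 * (ell2_norm \<eta>)\<^sup>2" .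
qed

lemma delta_in_ell2: "a \<in> A \<Longrightarrow> delta a \<in> ell2 A"
  by (auto simp: ell2_def delta_def intro!: summable_on_finite_support
      rev_finite_subset[of "{a}"] split: if_splits)

lemma ell2_inner_delta: "ell2_inner \<xi> (delta a) = \<xi> a"
proof -
  have "ell2_inner \<xi> (delta a) = \<xi> a * cnj (delta a a)"
    unfolding ell2_inner_def by (rule infsum_single_support) (auto simp: delta_def)
  then show ?thesis by (simp add: delta_def)
qed

lemma operator_norm_le:
  assumes "\<And>\<xi>. \<xi> \<in> ell2 A \<Longrightarrow> ell2_norm (T \<xi>) \<le> B * ell2_norm \<xi>" "B \<ge> 0"
  shows "operator_norm A T \<le> B"
  unfolding operator_norm_def
proof (rule cSUP_least)
  have "0 \<in> {\<xi> \<in> ell2 A. ell2_norm \<xi> \<le> 1}" by simp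
  then show "{\<xi> \<in> ell2 A. ell2_norm \<xi> \<le> 1} \<noteq> {}" by blast
  fix \<xi> assume \<xi>: "\<xi> \<in> {\<xi> \<in> ell2 A. ell2_norm \<xi> \<le> 1}"
  then have "ell2_norm (T \<xi>) \<le> B * ell2_norm \<xi>" using assms by blast
  also have "\<dots> \<le> B" using \<xi> assms(2) by (simp add: mult_left_le)
  finally show "ell2_norm (T \<xi>) \<le> B" .
qed

lemma operator_norm_zero: "operator_norm A 0 = 0"
proof -
  have "0 \<in> {\<xi> \<in> ell2 A. ell2_norm \<xi> \<le> 1}" by simp
  then have "{\<xi> \<in> ell2 A. ell2_norm \<xi> \<le> 1} \<noteq> {}" by blast
  then show ?thesis unfolding operator_norm_def by simp
qed

text \<open>The units must be nonempty here because the supremum of an empty set of reals carries no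
  useful value.\<close>

lemma family_norm_zero: "units G \<noteq> {} \<Longrightarrow> family_norm G 0 = 0"
  unfolding family_norm_def by (simp add: operator_norm_zero)

section \<open>Boundedness of the regular representation on the Steinberg algebra\<close>

text \<open>This makes each sum defining a convolution finite. Additivity of \<open>infsum\<close>
  requires summability, and a non-summable family would silently get the value 0. A function
  supported on one bisection qualifies, having at most one support point in each range
  fibre.\<close>

definition finite_rng_fibres :: "'g groupoid \<Rightarrow> ('g \<Rightarrow> complex) \<Rightarrow> bool"
  where "finite_rng_fibres G f \<longleftrightarrow> (\<forall>y. finite {k \<in> arrows G. rng G k = y \<and> f k \<noteq> 0})"

section \<open>Convolution as a sum over a range fibre, and the operators it defines\<close>

context groupoid
begin

lemma convolution_off_arrows: "g \<notin> arrows G \<Longrightarrow> convolution G f \<xi> g = 0"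
proof -
  assume "g \<notin> arrows G"
  then show ?thesis
    unfolding convolution_def using mul_closed by (intro infsum_0) auto
qed

lemma convolution_zero_left: "convolution G 0 \<xi> = 0"
  by (auto simp: convolution_def fun_eq_iff intro!: infsum_0)

text \<open>A factorisation of \<open>g\<close> into \<open>k\<close> and \<open>h\<close> is
  determined by \<open>k\<close>, because \<open>h\<close> must be k\<inverse>g, and every
  \<open>k\<close> with the range of \<open>g\<close> occurs.\<close>

lemma convolution_eq_infsum_rng_fibre:
  assumes g: "g \<in> arrows G"
  shows "convolution G f \<xi> g =
    (\<Sum>\<^sub>\<infinity>k \<in> {k \<in> arrows G. rng G k = rng G g}. f k * \<xi> (mul G (ginv G k) g))"
  unfolding convolution_def
proof (rule infsum_reindex_bij_witness[where i = "\<lambda>k. (k, mul G (ginv G k) g)" and j = fst])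
  fix a assume "a \<in> {(g1, g2). (g1, g2) \<in> composable G \<and> mul G g1 g2 = g}"
  then obtain k h where a: "a = (k, h)" "(k, h) \<in> composable G" "mul G k h = g" by auto
  have h: "mul G (ginv G k) g = h" using mul_inv_cancel a by blast
  show "(fst a, mul G (ginv G (fst a)) g) = a" using a h by simp
  show "fst a \<in> {k \<in> arrows G. rng G k = rng G g}"
    using a rng_mul by (auto simp: composable_def)
  show "f (fst a) * \<xi> (mul G (ginv G (fst a)) g) = (case a of (g1, g2) \<Rightarrow> f g1 * \<xi> g2)"
    using a h by simp
next
  fix k assume "k \<in> {k \<in> arrows G. rng G k = rng G g}"
  then show "(k, mul G (ginv G k) g) \<in> {(g1, g2). (g1, g2) \<in> composable G \<and> mul G g1 g2 = g}"
    using mul_cancel_inv g by auto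
qed auto

lemma summable_on_rng_fibre:
  assumes "finite_rng_fibres G f"
  shows "(\<lambda>k. f k * \<xi> k) summable_on {k \<in> arrows G. rng G k = y}"
proof (rule summable_on_finite_support)
  show "finite {k \<in> {k \<in> arrows G. rng G k = y}. f k * \<xi> k \<noteq> 0}"
    using assms unfolding finite_rng_fibres_def
    by (rule_tac rev_finite_subset[of "{k \<in> arrows G. rng G k = y \<and> f k \<noteq> 0}"]) auto
qed

lemma convolution_add_left:
  assumes "finite_rng_fibres G f1" "finite_rng_fibres G f2"
  shows "convolution G (f1 + f2) \<xi> = convolution G f1 \<xi> + convolution G f2 \<xi>"
proof
  fix g show "convolution G (f1 + f2) \<xi> g = (convolution G f1 \<xi> + convolution G f2 \<xi>) g"
    by (cases "g \<in> arrows G")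
      (simp_all add: convolution_eq_infsum_rng_fibre convolution_off_arrows distrib_right
        infsum_add summable_on_rng_fibre assms)
qed

lemma convolution_add_right:
  assumes "finite_rng_fibres G f"
  shows "convolution G f (\<xi> + \<eta>) = convolution G f \<xi> + convolution G f \<eta>"
proof
  fix g show "convolution G f (\<xi> + \<eta>) g = (convolution G f \<xi> + convolution G f \<eta>) g"
    by (cases "g \<in> arrows G")
      (simp_all add: convolution_eq_infsum_rng_fibre convolution_off_arrows distrib_left
        infsum_add summable_on_rng_fibre assms)
qed

lemma convolution_scale_left:
  "convolution G (\<lambda>g. c * f g) \<xi> = (\<lambda>g. c * convolution G f \<xi> g)"
proof
  fix g show "convolution G (\<lambda>g. c * f g) \<xi> g = c * convolution G f \<xi> g"
    by (cases "g \<in> arrows G")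
      (simp_all add: convolution_eq_infsum_rng_fibre convolution_off_arrows mult.assoc
        infsum_cmult_right')
qed

lemma convolution_scale_right:
  "convolution G f (\<lambda>g. c * \<xi> g) = (\<lambda>g. c * convolution G f \<xi> g)"
proof
  fix g show "convolution G f (\<lambda>g. c * \<xi> g) g = c * convolution G f \<xi> g"
    by (cases "g \<in> arrows G")
      (simp_all add: convolution_eq_infsum_rng_fibre convolution_off_arrows mult.left_commute
        infsum_cmult_right')
qed

text \<open>Only the term \<open>k = g\<close> survives: if k\<inverse>g is the unit
  \<open>src G g\<close>, then \<open>k\<close> times that unit is both \<open>k\<close> and
  \<open>g\<close>.\<close>

lemma convolution_delta_src:
  assumes g: "g \<in> arrows G"
  shows "convolution G f (delta (src G g)) g = f g"
proof -
  have "convolution G f (delta (src G g)) g = f g * delta (src G g) (mul G (ginv G g) g)"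
    unfolding convolution_eq_infsum_rng_fibre[OF g]
  proof (rule infsum_single_support)
    fix k assume k: "k \<in> {k \<in> arrows G. rng G k = rng G g}" "k \<noteq> g"
    have "mul G (ginv G k) g \<noteq> src G g"
    proof
      assume eq: "mul G (ginv G k) g = src G g"
      have c: "(k, src G g) \<in> composable G" "mul G k (src G g) = g"
        using mul_cancel_inv[of k g] k g eq by auto
      then have "src G k = src G g" using g by (simp add: composable_def rng_src)
      then show False using c(2) k mul_src[of k] by simp
    qed
    then show "f k * delta (src G g) (mul G (ginv G k) g) = 0" by (simp add: delta_def)
  qed (use g in auto)
  then show ?thesis using g by (simp add: inv_mul delta_def)
qed

text \<open>The matrix coefficient read off by \<open>as_function\<close> is the value computed in
  \<open>convolution_delta_src\<close>, so \<open>f\<close> can be recovered from its operators. Off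
  \<open>arrows G\<close> both sides vanish, on the right by hypothesis.\<close>

lemma as_function_regular_rep:
  assumes "\<And>g. g \<notin> arrows G \<Longrightarrow> f g = 0"
  shows "as_function G (regular_rep G f) = f"
proof
  fix g show "as_function G (regular_rep G f) g = f g"
  proof (cases "g \<in> arrows G")
    case True
    then have "src G g \<in> src_fibre G (src G g)" by (simp add: src_fibre_def src_closed src_src)
    then have "delta (src G g) \<in> ell2 (src_fibre G (src G g))" by (rule delta_in_ell2)
    then show ?thesis using True
      by (simp add: as_function_def regular_rep_def ell2_inner_delta src_in_units convolution_delta_src)
  next
    case False
    then show ?thesis using assms by (simp add: as_function_def)
  qed
qed

text \<open>Convolution by the indicator function of \<open>U\<close> is a partial isometry: it moves the
  value at \<open>k\<inverse>g\<close> to \<open>g\<close>, where \<open>k\<close> is the element of \<open>U\<close> with the range of \<open>g\<close>.\<close>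

lemma convolution_bisection:
  assumes U: "U \<subseteq> arrows G" "inj_on (rng G) U" "inj_on (src G) U"
    and \<xi>: "\<xi> \<in> ell2 (src_fibre G x)"
  defines "f \<equiv> (\<lambda>g. if g \<in> U then 1 else 0)"
  shows "convolution G f \<xi> \<in> ell2 (src_fibre G x)"
    and "(ell2_norm (convolution G f \<xi>))\<^sup>2 \<le> (ell2_norm \<xi>)\<^sup>2"
proof -
  define D where "D = {g \<in> arrows G. rng G g \<in> rng G ` U}"
  define k where "k g = the_inv_into U (rng G) (rng G g)" for g
  define m where "m g = mul G (ginv G (k g)) g" for g
  have k: "k g \<in> U" "k g \<in> arrows G" "rng G (k g) = rng G g" if "g \<in> D" for g
  proof -
    show "k g \<in> U" "rng G (k g) = rng G g"
      using that the_inv_into_into[OF U(2)] f_the_inv_into_f[OF U(2)] by (auto simp: k_def D_def)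
    then show "k g \<in> arrows G" using U by blast
  qed
  have m: "(k g, m g) \<in> composable G" "mul G (k g) (m g) = g" if "g \<in> D" for g
    using mul_cancel_inv[of "k g" g] k[OF that] that by (auto simp: m_def D_def)
  \<comment> \<open>The range of \<open>m g\<close> is the source of \<open>k g\<close>, which
    determines \<open>k g\<close> inside \<open>U\<close>; then \<open>g\<close> is the product of
    \<open>k g\<close> and \<open>m g\<close>.\<close>
  have inj: "inj_on m D"
  proof (rule inj_onI)
    fix g h assume gh: "g \<in> D" "h \<in> D" "m g = m h"
    have "src G (k g) = src G (k h)" using m[OF gh(1)] m[OF gh(2)] gh(3) by (auto simp: composable_def)
    then have "k g = k h" using k gh U(3) by (auto dest: inj_onD)
    then show "g = h" using m gh by metis
  qed
  have on_D: "convolution G f \<xi> g = \<xi> (m g)" if g: "g \<in> D" for g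
  proof -
    have "convolution G f \<xi> g = f (k g) * \<xi> (m g)"
      unfolding m_def using g
    proof (subst convolution_eq_infsum_rng_fibre)
      show "(\<Sum>\<^sub>\<infinity>h \<in> {h \<in> arrows G. rng G h = rng G g}. f h * \<xi> (mul G (ginv G h) g)) =
          f (k g) * \<xi> (mul G (ginv G (k g)) g)"
      proof (rule infsum_single_support)
        fix h assume h: "h \<in> {h \<in> arrows G. rng G h = rng G g}" "h \<noteq> k g"
        then have "h \<notin> U" using k[OF g] inj_onD[OF U(2), of h "k g"] by auto
        then show "f h * \<xi> (mul G (ginv G h) g) = 0" by (simp add: f_def)
      qed (use k[OF g] in auto)
    qed (auto simp: D_def)
    then show ?thesis using k[OF g] by (simp add: f_def)
  qed
  have off_D: "convolution G f \<xi> g = 0" if g: "g \<notin> D" for g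
  proof (cases "g \<in> arrows G")
    case True
    have "(\<Sum>\<^sub>\<infinity>h \<in> {h \<in> arrows G. rng G h = rng G g}. f h * \<xi> (mul G (ginv G h) g)) = 0"
      using g True by (intro infsum_0) (auto simp: f_def D_def image_iff)
    then show ?thesis using True by (simp add: convolution_eq_infsum_rng_fibre)
  qed (simp add: convolution_off_arrows)
  have sum: "(\<lambda>a. (cmod (\<xi> a))\<^sup>2) summable_on UNIV" using \<xi> by (simp add: ell2_def)
  then have sum_m: "(\<lambda>a. (cmod (\<xi> a))\<^sup>2) summable_on m ` D" by (rule summable_on_subset) simp
  have iff: "(\<lambda>g. (cmod (convolution G f \<xi> g))\<^sup>2) summable_on UNIV \<longleftrightarrow>
      ((\<lambda>a. (cmod (\<xi> a))\<^sup>2) \<circ> m) summable_on D"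
    by (rule summable_on_cong_neutral) (auto simp: on_D off_D)
  have "convolution G f \<xi> g = 0" if g: "g \<notin> src_fibre G x" for g
  proof (cases "g \<in> D")
    case True
    then have "src G (m g) \<noteq> x"
      using g m[OF True] src_mul[OF m(1)[OF True]] by (auto simp: D_def src_fibre_def)
    then have "\<xi> (m g) = 0" using \<xi> by (auto simp: ell2_def src_fibre_def)
    then show ?thesis using on_D True by simp
  qed (rule off_D)
  then show "convolution G f \<xi> \<in> ell2 (src_fibre G x)"
    using iff sum_m summable_on_reindex[OF inj] by (auto simp: ell2_def)
  have "(ell2_norm (convolution G f \<xi>))\<^sup>2 = infsum ((\<lambda>a. (cmod (\<xi> a))\<^sup>2) \<circ> m) D"
    unfolding ell2_norm_sq by (rule infsum_cong_neutral) (auto simp: on_D off_D)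
  also have "\<dots> = infsum (\<lambda>a. (cmod (\<xi> a))\<^sup>2) (m ` D)"
    using infsum_reindex[OF inj] by metis
  also have "\<dots> \<le> (ell2_norm \<xi>)\<^sup>2"
    unfolding ell2_norm_sq by (rule infsum_mono2[OF sum_m sum]) auto
  finally show "(ell2_norm (convolution G f \<xi>))\<^sup>2 \<le> (ell2_norm \<xi>)\<^sup>2" .
qed

lemma regular_rep_bounded:
  assumes fin: "finite_rng_fibres G f" and B: "B \<ge> 0"
    and bd: "\<And>x \<xi>. \<xi> \<in> ell2 (src_fibre G x) \<Longrightarrow> convolution G f \<xi> \<in> ell2 (src_fibre G x)"
      "\<And>x \<xi>. \<xi> \<in> ell2 (src_fibre G x) \<Longrightarrow> (ell2_norm (convolution G f \<xi>))\<^sup>2 \<le> B * (ell2_norm \<xi>)\<^sup>2"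
  shows "regular_rep G f \<in> bounded_families G"
proof -
  have le: "ell2_norm (regular_rep G f x \<xi>) \<le> sqrt B * ell2_norm \<xi>"
    if "x \<in> units G" "\<xi> \<in> ell2 (src_fibre G x)" for x \<xi>
  proof (rule power2_le_imp_le)
    show "(ell2_norm (regular_rep G f x \<xi>))\<^sup>2 \<le> (sqrt B * ell2_norm \<xi>)\<^sup>2"
      using bd(2)[OF that(2)] that B by (simp add: regular_rep_def power_mult_distrib)
  qed (simp add: B ell2_norm_nonneg)
  have "regular_rep G f x \<in> bounded_operators (src_fibre G x)" if x: "x \<in> units G" for x
    unfolding bounded_operators_def
  proof (intro CollectI conjI ballI allI impI)
    show "\<exists>B. \<forall>\<xi> \<in> ell2 (src_fibre G x). ell2_norm (regular_rep G f x \<xi>) \<le> B * ell2_norm \<xi>"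
      using le[OF x] by blast
  qed (use x in \<open>simp_all add: regular_rep_def bd ell2_add ell2_scale convolution_add_right fin
      convolution_scale_right\<close>)
  moreover have "bdd_above ((\<lambda>x. operator_norm (src_fibre G x) (regular_rep G f x)) ` units G)"
    using le B by (intro bdd_aboveI2[where M = "sqrt B"] operator_norm_le) auto
  moreover have "regular_rep G f x = 0" if "x \<notin> units G" for x
    using that by (auto simp: regular_rep_def)
  ultimately show ?thesis by (simp add: bounded_families_def)
qed

text \<open>Each bisection contributes a multiple of a contraction, and finite sums preserve a bound
  that is uniform in \<open>x\<close>. The induction also carries \<open>finite_rng_fibres\<close>,
  which splitting a convolution over a sum relies on.\<close>

lemma steinberg_regular_rep_bounded:
  assumes "f \<in> steinberg_algebra G"
  shows "regular_rep G f \<in> bounded_families G"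
proof -
  let ?P = "\<lambda>f. finite_rng_fibres G f \<and> (\<exists>B\<ge>0. \<forall>x. \<forall>\<xi> \<in> ell2 (src_fibre G x).
    convolution G f \<xi> \<in> ell2 (src_fibre G x) \<and>
    (ell2_norm (convolution G f \<xi>))\<^sup>2 \<le> B * (ell2_norm \<xi>)\<^sup>2)"
  have "?P f"
    using assms unfolding steinberg_algebra_def
  proof (induction rule: fun_module.span_induct_alt)
    case base
    show ?case
      unfolding convolution_zero_left
      using ell2_zero[unfolded zero_fun_def] ell2_norm_zero[unfolded zero_fun_def]
      by (auto simp: finite_rng_fibres_def intro!: exI[of _ 0])
  next
    case (step d u f)
    then obtain c U where u: "u = (\<lambda>g. if g \<in> U then c else 0)" and U: "open_bisection G U" by blast
    have U': "U \<subseteq> arrows G" "inj_on (rng G) U" "inj_on (src G) U"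
      using U openin_subset by (auto simp: open_bisection_def)
    obtain B where fin: "finite_rng_fibres G f" and B: "B \<ge> 0"
      "\<And>x \<xi>. \<xi> \<in> ell2 (src_fibre G x) \<Longrightarrow> convolution G f \<xi> \<in> ell2 (src_fibre G x)"
      "\<And>x \<xi>. \<xi> \<in> ell2 (src_fibre G x) \<Longrightarrow> (ell2_norm (convolution G f \<xi>))\<^sup>2 \<le> B * (ell2_norm \<xi>)\<^sup>2"
      using step.IH by blast
    \<comment> \<open>The summand is written as a scalar times an indicator function, to which
      \<open>convolution_bisection\<close> applies.\<close>
    define v :: "'g \<Rightarrow> complex" where "v = (\<lambda>g. if g \<in> U then 1 else 0)"
    define e where "e = d * c"
    have du: "(\<lambda>g. d * u g) = (\<lambda>g. e * v g)" by (auto simp: u v_def e_def)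
    have finU: "finite {k \<in> U. rng G k = y}" for y
    proof (cases "\<exists>k \<in> U. rng G k = y")
      case True
      then obtain k where "k \<in> U" "rng G k = y" by blast
      then have "{k \<in> U. rng G k = y} = {k}" using U'(2) by (auto dest: inj_onD)
      then show ?thesis by simp
    qed (auto intro: finite_subset[of _ "{}"])
    have finev: "finite_rng_fibres G (\<lambda>g. e * v g)"
      unfolding finite_rng_fibres_def
      by (intro allI rev_finite_subset[OF finU]) (auto simp: v_def split: if_splits)
    have "finite_rng_fibres G ((\<lambda>g. e * v g) + f)"
      unfolding finite_rng_fibres_def
    proof
      fix y
      have "finite ({k \<in> arrows G. rng G k = y \<and> e * v k \<noteq> 0} \<union> {k \<in> arrows G. rng G k = y \<and> f k \<noteq> 0})"
        using fin finev by (simp add: finite_rng_fibres_def)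
      then show "finite {k \<in> arrows G. rng G k = y \<and> ((\<lambda>g. e * v g) + f) k \<noteq> 0}"
        by (rule rev_finite_subset) auto
    qed
    moreover have "convolution G ((\<lambda>g. e * v g) + f) \<xi> \<in> ell2 (src_fibre G x) \<and>
        (ell2_norm (convolution G ((\<lambda>g. e * v g) + f) \<xi>))\<^sup>2 \<le>
          (2 * (cmod e)\<^sup>2 + 2 * B) * (ell2_norm \<xi>)\<^sup>2"
      if \<xi>: "\<xi> \<in> ell2 (src_fibre G x)" for x \<xi>
    proof -
      note v = convolution_bisection[OF U' \<xi>, folded v_def]
      have eq: "convolution G ((\<lambda>g. e * v g) + f) \<xi> =
          (\<lambda>g. e * convolution G v \<xi> g) + convolution G f \<xi>"
        by (simp add: convolution_add_left[OF finev fin] convolution_scale_left)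
      note ev = ell2_scale[OF v(1), of e]
      note sum = ell2_add[OF ev(1) B(2)[OF \<xi>]]
      have "(cmod e)\<^sup>2 * (ell2_norm (convolution G v \<xi>))\<^sup>2 \<le> (cmod e)\<^sup>2 * (ell2_norm \<xi>)\<^sup>2"
        using v(2) by (simp add: mult_left_mono)
      then show ?thesis
        using sum B(3)[OF \<xi>] ev(2) unfolding eq by (simp add: algebra_simps)
    qed
    moreover have "2 * (cmod e)\<^sup>2 + 2 * B \<ge> 0" using B(1) by simp
    ultimately show ?case unfolding du by blast
  qed
  then show ?thesis using regular_rep_bounded by blast
qed

section \<open>The zero element, and the Steinberg algebra inside \<open>Cc G\<close>\<close>

lemma regular_rep_zero: "regular_rep G 0 = 0"
  by (intro ext) (simp add: regular_rep_def convolution_zero_left)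

lemma zero_in_singular_ideal:
  assumes "units G \<noteq> {}"
  shows "0 \<in> singular_ideal G"
proof -
  have "0 \<in> Cc G" "0 \<in> steinberg_algebra G"
    unfolding Cc_def steinberg_algebra_def by (rule fun_module.span_zero)+
  then have "0 \<in> bounded_families G"
    using steinberg_regular_rep_bounded regular_rep_zero by metis
  moreover have "family_norm G (0 - regular_rep G 0) = 0"
    using family_norm_zero[OF assms] by (simp add: regular_rep_zero)
  moreover have "as_function G 0 = 0"
    by (auto simp: as_function_def ell2_inner_delta fun_eq_iff)
  ultimately show ?thesis
    using \<open>0 \<in> Cc G\<close> by (force simp: singular_ideal_def reduced_algebra_def supp_open_def)
qed

lemma Cc_off_arrows:
  assumes "f \<in> Cc G" "g \<notin> arrows G"
  shows "f g = 0"
  using assms(1) unfolding Cc_def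
proof (induction rule: fun_module.span_induct_alt)
  case (step c u f)
  then obtain U where "openin (gtop G) U" "u \<in> Cc_on G U" by (auto simp: open_bisection_def)
  then have "u g = 0" using openin_subset assms(2) by (auto simp: Cc_on_def)
  then show ?case using step by simp
qed simp

text \<open>Supports are closed up inside the bisection. When this bisection is compact, every
  closed subset of it is compact, even if \<open>G\<close> is not Hausdorff.\<close>

lemma steinberg_subset_Cc: "steinberg_algebra G \<subseteq> Cc G"
  unfolding steinberg_algebra_def Cc_def
proof (rule fun_module.span_mono, safe)
  fix c :: complex and U assume U: "open_bisection G U" "compactin (gtop G) U"
  let ?f = "\<lambda>g. if g \<in> U then c else 0" and ?X = "subtopology (gtop G) U"
  have "compact_space ?X" using U by (simp add: compact_space_subtopology)
  then have "compactin ?X (?X closure_of (U \<inter> supp_open ?f))"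
    by (simp add: closedin_compact_space)
  moreover have "continuous_map ?X euclidean ?f"
    by (rule continuous_map_eq[of _ _ "\<lambda>_. c"]) auto
  ultimately have "?f \<in> Cc_on G U" by (simp add: Cc_on_def)
  then show "?f \<in> (\<Union>U \<in> {U. open_bisection G U}. Cc_on G U)" using U by blast
qed

end

section \<open>Singular functions\<close>

text \<open>Closure of \<open>S\<close> under scaling lets each coefficient be absorbed into its
  generator, leaving a plain indexed sum.\<close>

lemma complex_span_as_sum:
  assumes "f \<in> complex_span S" and scale: "\<And>c u. u \<in> S \<Longrightarrow> (\<lambda>g. c * u g) \<in> S"
  obtains n \<phi> where "\<And>i. i < (n::nat) \<Longrightarrow> \<phi> i \<in> S" "f = (\<lambda>g. \<Sum>i<n. \<phi> i g)"
proof -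
  have "\<exists>n \<phi>. (\<forall>i < (n::nat). \<phi> i \<in> S) \<and> f = (\<lambda>g. \<Sum>i<n. \<phi> i g)"
    using assms(1)
  proof (induction rule: fun_module.span_induct_alt)
    case base
    show ?case by (intro exI[of _ 0]) (auto simp: fun_eq_iff)
  next
    case (step c u f)
    then obtain n \<phi> where \<phi>: "\<forall>i < (n::nat). \<phi> i \<in> S" "f = (\<lambda>g. \<Sum>i<n. \<phi> i g)" by blast
    let ?\<psi> = "\<phi>(n := \<lambda>g. c * u g)"
    have "(\<Sum>i<Suc n. ?\<psi> i g) = c * u g + (\<Sum>i<n. \<phi> i g)" for g
      by simp
    then show ?case
      using \<phi> scale[OF step.hyps] less_Suc_eq
      by (intro exI[of _ "Suc n"] exI[of _ ?\<psi>]) (auto simp: fun_eq_iff)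
  qed
  then show thesis using that by blast
qed

lemma steinberg_as_sum:
  assumes "f \<in> steinberg_algebra G"
  obtains n c U where "\<And>i. i < (n::nat) \<Longrightarrow> open_bisection G (U i)"
    "\<And>i. i < n \<Longrightarrow> compactin (gtop G) (U i)"
    "f = (\<lambda>g. \<Sum>i<n. if g \<in> U i then c i else 0)"
proof -
  let ?S = "{(\<lambda>g. if g \<in> U then c else 0 :: complex) | c U. open_bisection G U \<and> compactin (gtop G) U}"
  have scale: "(\<lambda>g. d * u g) \<in> ?S" if "u \<in> ?S" for d u
  proof -
    from that obtain c U where "u = (\<lambda>g. if g \<in> U then c else 0)" "open_bisection G U"
        "compactin (gtop G) U"
      by (elim CollectE exE conjE)
    then show ?thesis by (intro CollectI exI[of _ "d * c"] exI[of _ U]) (auto simp: fun_eq_iff)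
  qed
  obtain n \<phi> where \<phi>: "\<And>i. i < (n::nat) \<Longrightarrow> \<phi> i \<in> ?S" "f = (\<lambda>g. \<Sum>i<n. \<phi> i g)"
    by (rule complex_span_as_sum[OF assms[unfolded steinberg_algebra_def]], rule scale) blast+
  have "\<forall>i. \<exists>c U. i < n \<longrightarrow>
      \<phi> i = (\<lambda>g. if g \<in> U then c else 0) \<and> open_bisection G U \<and> compactin (gtop G) U"
    using \<phi>(1) by blast
  then obtain c U where "\<And>i. i < n \<Longrightarrow> \<phi> i = (\<lambda>g. if g \<in> U i then c i else 0) \<and>
      open_bisection G (U i) \<and> compactin (gtop G) (U i)"
    by metis
  then show thesis using that[of n U c] \<phi>(2) by simp
qed

lemma Cc_on_scale:
  assumes "f \<in> Cc_on G U"
  shows "(\<lambda>g. c * f g) \<in> Cc_on G U"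
proof (cases "c = 0")
  case True
  then show ?thesis by (simp add: Cc_on_def supp_open_def)
next
  case False
  then have "supp_open (\<lambda>g. c * f g) = supp_open f" by (simp add: supp_open_def)
  moreover have "continuous_map (subtopology (gtop G) U) euclidean (\<lambda>g. c * f g)"
    using continuous_map_compose[of _ euclidean f euclidean "\<lambda>z. c * z"] assms
    by (simp add: Cc_on_def o_def continuous_on_mult_left)
  ultimately show ?thesis using assms by (simp add: Cc_on_def)
qed

lemma Cc_as_sum:
  assumes "f \<in> Cc G"
  obtains n \<phi> U where "\<And>i. i < (n::nat) \<Longrightarrow> open_bisection G (U i)"
    "\<And>i. i < n \<Longrightarrow> \<phi> i \<in> Cc_on G (U i)" "f = (\<lambda>g. \<Sum>i<n. \<phi> i g)"
proof -
  let ?S = "\<Union>U \<in> {U. open_bisection G U}. Cc_on G U"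
  have scale: "(\<lambda>g. d * u g) \<in> ?S" if "u \<in> ?S" for d u
    using that Cc_on_scale by blast
  obtain n \<phi> where \<phi>: "\<And>i. i < (n::nat) \<Longrightarrow> \<phi> i \<in> ?S" "f = (\<lambda>g. \<Sum>i<n. \<phi> i g)"
    by (rule complex_span_as_sum[OF assms[unfolded Cc_def]], rule scale) blast+
  have "\<forall>i. \<exists>U. i < n \<longrightarrow> open_bisection G U \<and> \<phi> i \<in> Cc_on G U"
    using \<phi>(1) by blast
  then obtain U where "\<And>i. i < n \<Longrightarrow> open_bisection G (U i) \<and> \<phi> i \<in> Cc_on G (U i)"
    by metis
  then show thesis using that[of n U \<phi>] \<phi>(2) by simp
qed

lemma open_bisection_unique:
  "open_bisection G U \<Longrightarrow> g \<in> U \<Longrightarrow> h \<in> U \<Longrightarrow> src G g = src G h \<Longrightarrow> g = h"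
  by (auto simp: open_bisection_def dest: inj_onD)

section \<open>Source images of supports of singular Steinberg functions\<close>

context etale_groupoid
begin

lemma openin_vimage_src:
  "openin (units_top G) W \<Longrightarrow> openin (gtop G) {g \<in> arrows G. src G g \<in> W}"
  using continuous_src_units by (auto simp: continuous_map_def)

text \<open>Points of the support are sorted by the set of bisections containing them. The source
  map turns the resulting pieces into differences of open sets, so interior of the image must come
  from a single piece, and it lifts back to interior of the support.\<close>

lemma steinberg_src_support_interior:
  assumes f: "f \<in> steinberg_algebra G" and empty: "gtop G interior_of (supp_open f) = {}"
  shows "units_top G interior_of (src G ` supp_open f) = {}"
proof (rule ccontr)
  assume ne: "units_top G interior_of (src G ` supp_open f) \<noteq> {}"
  obtain n c U where U: "\<And>i. i < (n::nat) \<Longrightarrow> open_bisection G (U i)"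
    and f_eq: "f = (\<lambda>g. \<Sum>i<n. if g \<in> U i then c i else 0)"
    using steinberg_as_sum[OF f] by metis
  have f_sum: "f g = (\<Sum>i\<in>{i. i < n \<and> g \<in> U i}. c i)" for g
    unfolding f_eq by (rule sum.mono_neutral_cong_right) auto
  \<comment> \<open>\<open>M S\<close> minus \<open>Q S\<close> consists of the points lying in the
    bisections indexed by \<open>S\<close> and in no others, and there \<open>f\<close> equals
    \<open>sum c S\<close>. Nonemptiness of \<open>S\<close> is imposed because \<open>M {}\<close>
    would be the whole type.\<close>
  define M where "M S = (\<Inter>i\<in>S. U i)" for S
  define Q where "Q S = M S \<inter> (\<Union>j\<in>{..<n} - S. U j)" for S
  define \<S> where "\<S> = {S. S \<subseteq> {..<n} \<and> S \<noteq> {} \<and> sum c S \<noteq> 0}"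
  have openU: "openin (gtop G) (U i)" if "i < n" for i
    using U[OF that] by (simp add: open_bisection_def)
  have openM: "openin (gtop G) (M S)" if "S \<in> \<S>" for S
    unfolding M_def using that openU finite_subset[of S "{..<n}"]
    by (intro openin_Inter) (auto simp: \<S>_def)
  have openQ: "openin (gtop G) (Q S)" if "S \<in> \<S>" for S
    unfolding Q_def using openM[OF that] openU by (intro openin_Int openin_Union) auto
  \<comment> \<open>As \<open>S\<close> is nonempty, \<open>M S\<close> lies in one bisection and
    the source map is injective on it. Hence the image of \<open>M S - Q S\<close> is the difference
    of the two images.\<close>
  have src_Q: "g \<in> Q S" if "S \<in> \<S>" "g \<in> M S" "src G g \<in> src G ` Q S" for S g
  proof -
    obtain h where h: "h \<in> Q S" "src G g = src G h" using \<open>src G g \<in> src G ` Q S\<close> by blast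
    have "S \<noteq> {}" using that(1) by (simp add: \<S>_def)
    then obtain i where i: "i \<in> S" by blast
    then have "i < n" using that(1) by (auto simp: \<S>_def)
    with i have "g = h" using open_bisection_unique[OF U[of i]] that h by (auto simp: M_def Q_def)
    then show ?thesis using h by simp
  qed
  let ?V = "units_top G interior_of (src G ` supp_open f)"
  have "?V \<subseteq> \<Union>((\<lambda>S. src G ` M S - src G ` Q S) ` \<S>)"
  proof
    fix y assume "y \<in> ?V"
    then obtain g where g: "f g \<noteq> 0" "y = src G g"
      using interior_of_subset[of "units_top G" "src G ` supp_open f"] by (auto simp: supp_open_def)
    define S where "S = {i. i < n \<and> g \<in> U i}"
    have "sum c S \<noteq> 0" using g f_sum by (simp add: S_def)
    moreover from this have "S \<noteq> {}" by (metis sum.empty)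
    ultimately have S: "S \<in> \<S>" by (auto simp: \<S>_def S_def)
    have "g \<in> M S" "g \<notin> Q S" by (auto simp: M_def Q_def S_def)
    then show "y \<in> \<Union>((\<lambda>S. src G ` M S - src G ` Q S) ` \<S>)"
      using g S src_Q by blast
  qed
  moreover have "finite ((\<lambda>S. src G ` M S - src G ` Q S) ` \<S>)"
    by (auto simp: \<S>_def)
  moreover have "\<exists>P R. openin (units_top G) P \<and> openin (units_top G) R \<and> A = P - R"
    if A: "A \<in> (\<lambda>S. src G ` M S - src G ` Q S) ` \<S>" for A
  proof -
    obtain S where "S \<in> \<S>" "A = src G ` M S - src G ` Q S" using A by blast
    then show ?thesis using open_map_src openM[of S] openQ[of S] by (auto simp: open_map_def)
  qed
  moreover have "openin (units_top G) ?V" by simp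
  ultimately have "\<exists>A \<in> (\<lambda>S. src G ` M S - src G ` Q S) ` \<S>.
      \<exists>V. openin (units_top G) V \<and> V \<noteq> {} \<and> V \<subseteq> A"
    using ne by (intro finite_Union_open_Diff_open_interior[where V = ?V])
  then obtain A V where "A \<in> (\<lambda>S. src G ` M S - src G ` Q S) ` \<S>"
      and V: "openin (units_top G) V" "V \<noteq> {}" "V \<subseteq> A"
    by blast
  then obtain S where "S \<in> \<S>" "A = src G ` M S - src G ` Q S" by blast
  with V(3) have S: "S \<in> \<S>" "V \<subseteq> src G ` M S - src G ` Q S" by simp_all
  \<comment> \<open>The part of \<open>M S\<close> lying over \<open>V\<close>. It avoids
    \<open>Q S\<close>, since its sources avoid the image of \<open>Q S\<close>, so \<open>f\<close>
    is the nonzero constant \<open>sum c S\<close> on it.\<close>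
  define O' where "O' = M S \<inter> {g \<in> arrows G. src G g \<in> V}"
  have "openin (gtop G) O'"
    unfolding O'_def using openM[OF S(1)] openin_vimage_src[OF V(1)] by blast
  moreover have "O' \<subseteq> supp_open f"
  proof
    fix g assume g: "g \<in> O'"
    then have "g \<notin> Q S" using S(2) by (auto simp: O'_def)
    moreover have "g \<in> M S" "S \<subseteq> {..<n}" using g S(1) by (auto simp: O'_def \<S>_def)
    ultimately have "{i. i < n \<and> g \<in> U i} = S"
      by (auto simp: M_def Q_def)
    then show "g \<in> supp_open f" using S f_sum by (simp add: supp_open_def \<S>_def)
  qed
  ultimately have "O' \<subseteq> {}" using empty interior_of_maximal by metis
  moreover have "O' \<noteq> {}"
    using V(2) S openM[OF S(1)] openin_subset by (fastforce simp: O'_def)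
  ultimately show False by simp
qed

end

lemma sum_fun_apply: "(\<Sum>i\<in>I. F i) g = (\<Sum>i\<in>I. F i g :: 'b::comm_monoid_add)"
  by (induction I rule: infinite_finite_induct) auto

section \<open>Steinberg functions obtained by freezing the summands of a function in
  \<open>Cc G\<close>\<close>

context ample_groupoid
begin

lemma Cc_singular_imp_steinberg_singular:
  assumes f: "f \<in> Cc G" and "f \<noteq> 0"
    and empty: "units_top G interior_of (src G ` supp_open f) = {}"
  obtains h where "h \<in> steinberg_singular_ideal G" "h \<noteq> 0"
proof -
  obtain n \<phi> U where U: "\<And>i. i < (n::nat) \<Longrightarrow> open_bisection G (U i)"
    and \<phi>: "\<And>i. i < n \<Longrightarrow> \<phi> i \<in> Cc_on G (U i)" and f_eq: "f = (\<lambda>g. \<Sum>i<n. \<phi> i g)"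
    using Cc_as_sum[OF f] by metis
  have \<phi>_off: "\<phi> i g = 0" if "i < n" "g \<notin> U i" for i g
    using \<phi>[OF that(1)] that(2) by (simp add: Cc_on_def)
  obtain g0 where g0: "f g0 \<noteq> 0" using \<open>f \<noteq> 0\<close> by (auto simp: fun_eq_iff)
  then have g0_arr: "g0 \<in> arrows G" using Cc_off_arrows[OF f] by blast
  define x0 where "x0 = src G g0"
  have x0: "x0 \<in> units G" using g0_arr src_in_units by (simp add: x0_def)
  \<comment> \<open>These are the bisections with a point over \<open>x0\<close>. That point,
    \<open>p i\<close> below, is where the summand is frozen; the other summands will vanish over a
    neighbourhood of \<open>x0\<close>.\<close>
  define I where "I = {i. i < n \<and> x0 \<in> src G ` U i}"
  have finI: "finite I" by (simp add: I_def)
  have "\<forall>i. \<exists>p. i \<in> I \<longrightarrow> p \<in> U i \<and> src G p = x0" by (auto simp: I_def)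
  then obtain p where p: "\<And>i. i \<in> I \<Longrightarrow> p i \<in> U i \<and> src G (p i) = x0" by metis
  define c where "c i = \<phi> i (p i)" for i
  have "\<exists>\<delta>>0. \<forall>S\<subseteq>I. cmod (sum c S) < \<delta> \<longrightarrow> sum c S = 0"
  proof -
    \<comment> \<open>The nonzero subset sums are finite in number, so their moduli have a positive
      lower bound. Inserting 1 makes the minimum exist even if every subset sum is zero.\<close>
    define D where "D = (\<lambda>S. cmod (sum c S)) ` {S. S \<subseteq> I \<and> sum c S \<noteq> 0}"
    have D: "finite (insert 1 D)" "\<And>d. d \<in> insert 1 D \<Longrightarrow> d > 0"
      using finI by (auto simp: D_def)
    have "Min (insert 1 D) > 0" using D(1) D(2) Min_in[OF D(1)] by blast
    moreover have "Min (insert 1 D) \<le> cmod (sum c S)" if "S \<subseteq> I" "sum c S \<noteq> 0" for S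
      using D(1) that by (intro Min_le) (auto simp: D_def)
    ultimately show ?thesis
      by (intro exI[of _ "Min (insert 1 D)"]) (metis linorder_not_less)
  qed
  then obtain \<delta> where \<delta>: "\<delta> > 0" "\<And>S. S \<subseteq> I \<Longrightarrow> cmod (sum c S) < \<delta> \<Longrightarrow> sum c S = 0" by blast
  \<comment> \<open>At most \<open>n\<close> summands, each with error at most
    \<open>\<epsilon>\<close>, then have total error strictly below the gap
    \<open>\<delta>\<close>.\<close>
  define \<epsilon> where "\<epsilon> = \<delta> / (real n + 1)"
  have \<epsilon>: "\<epsilon> > 0" "real n * \<epsilon> < \<delta>" using \<delta>(1) by (auto simp: \<epsilon>_def field_simps)
  \<comment> \<open>For \<open>i\<close> in \<open>I\<close> the neighbourhood must also lie in the
    source image of \<open>U i\<close>, as required for restricting \<open>U i\<close> to a compact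
    open bisection.\<close>
  define near where "near i N \<longleftrightarrow> openin (units_top G) N \<and> x0 \<in> N \<and>
      (i \<in> I \<longrightarrow> N \<subseteq> src G ` U i \<and> (\<forall>g \<in> U i. src G g \<in> N \<longrightarrow> cmod (\<phi> i g - c i) < \<epsilon>)) \<and>
      (i \<notin> I \<longrightarrow> (\<forall>g. src G g \<in> N \<longrightarrow> \<phi> i g = 0))" for i N
  have "\<exists>N. near i N" if i: "i < n" for i
  proof -
    have oU: "openin (gtop G) (U i)" using U[OF i] by (simp add: open_bisection_def)
    let ?X = "subtopology (gtop G) (U i)"
    have UX: "topspace ?X = U i" using oU openin_subset by auto
    have cont: "continuous_map ?X euclidean (\<phi> i)"
      and K: "compactin ?X (?X closure_of (U i \<inter> supp_open (\<phi> i)))"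
      and off: "\<And>g. g \<notin> U i \<Longrightarrow> \<phi> i g = 0"
      using \<phi>[OF i] by (auto simp: Cc_on_def)
    show ?thesis
    proof (cases "i \<in> I")
      case True
      \<comment> \<open>On this open part of \<open>U i\<close> the summand is close to its value at
        \<open>p i\<close>. Injectivity of the source map on \<open>U i\<close> shows that every
        point of \<open>U i\<close> over its image lies in \<open>B\<close>.\<close>
      define B where "B = {g \<in> U i. \<phi> i g \<in> ball (c i) \<epsilon>}"
      have "openin ?X B"
        using openin_continuous_map_preimage[OF cont, of "ball (c i) \<epsilon>"]
        unfolding UX B_def by simp
      then have "openin (gtop G) B" using oU openin_trans_full by blast
      then have "openin (units_top G) (src G ` B)" using open_map_src by (simp add: open_map_def)
      moreover have "x0 \<in> src G ` B"
      proof
        show "p i \<in> B" "x0 = src G (p i)" using p[OF True] \<epsilon>(1) by (auto simp: B_def c_def)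
      qed
      moreover have "cmod (\<phi> i g - c i) < \<epsilon>" if g: "g \<in> U i" "src G g \<in> src G ` B" for g
      proof -
        obtain b where "b \<in> B" "src G g = src G b" using g(2) by blast
        moreover from this have "g = b"
          using open_bisection_unique[OF U[OF i] g(1)] by (simp add: B_def)
        ultimately have "g \<in> B" by simp
        then show ?thesis by (simp add: B_def dist_norm norm_minus_commute)
      qed
      ultimately show ?thesis using True
        unfolding near_def by (intro exI[of _ "src G ` B"]) (auto simp: B_def)
    next
      case False
      \<comment> \<open>The support is compact in \<open>U i\<close>, so its source image is
        compact, hence closed in the Hausdorff unit space. It misses \<open>x0\<close>, and its
        complement is the required neighbourhood. Working in the units avoids closures in
        \<open>G\<close>, where compact sets need not be closed.\<close>
      define K where "K = ?X closure_of (U i \<inter> supp_open (\<phi> i))"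
      have "compactin (gtop G) K" "K \<subseteq> U i"
        using K by (auto simp: K_def compactin_subtopology)
      then have "compactin (units_top G) (src G ` K)"
        using image_compactin continuous_src_units by blast
      then have "closedin (units_top G) (src G ` K)"
        using Hausdorff_units compactin_imp_closedin by blast
      then have "openin (units_top G) (units G - src G ` K)"
        using openin_diff[OF openin_topspace, of "units_top G"] by simp
      moreover have "x0 \<notin> src G ` K" using False i \<open>K \<subseteq> U i\<close> by (auto simp: I_def)
      moreover have "\<phi> i g = 0" if "src G g \<in> units G - src G ` K" for g
      proof (rule ccontr)
        assume "\<phi> i g \<noteq> 0"
        then have "g \<in> U i \<inter> supp_open (\<phi> i)" using off by (auto simp: supp_open_def)
        then have "g \<in> K"
          using closure_of_subset[of "U i \<inter> supp_open (\<phi> i)" ?X] UX by (auto simp: K_def)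
        then show False using that by blast
      qed
      ultimately show ?thesis
        using False x0 unfolding near_def by (intro exI[of _ "units G - src G ` K"]) auto
    qed
  qed
  then have "\<forall>i. \<exists>N. i < n \<longrightarrow> near i N" by blast
  then obtain N where "\<forall>i. i < n \<longrightarrow> near i (N i)" by (rule choice[THEN exE])
  then have N: "\<And>i. i < n \<Longrightarrow> openin (units_top G) (N i)" "\<And>i. i < n \<Longrightarrow> x0 \<in> N i"
      "\<And>i. i \<in> I \<Longrightarrow> i < n \<Longrightarrow> N i \<subseteq> src G ` U i"
      "\<And>i g. i \<in> I \<Longrightarrow> i < n \<Longrightarrow> g \<in> U i \<Longrightarrow> src G g \<in> N i \<Longrightarrow> cmod (\<phi> i g - c i) < \<epsilon>"
      "\<And>i g. i \<notin> I \<Longrightarrow> i < n \<Longrightarrow> src G g \<in> N i \<Longrightarrow> \<phi> i g = 0"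
    by (simp_all add: near_def)
  \<comment> \<open>Intersecting with \<open>units G\<close> covers the case of an empty index set,
    whose intersection is the whole type.\<close>
  define V where "V = (\<Inter>i\<in>{..<n}. N i) \<inter> units G"
  have "openin (units_top G) V"
    using N(1) openin_Int_Inter[of "N ` {..<n}" "units_top G" "units G"]
      openin_topspace[of "units_top G"] by (auto simp: V_def Int_commute)
  moreover have "x0 \<in> V" using N(2) x0 by (auto simp: V_def)
  ultimately obtain W where W: "openin (units_top G) W" "compactin (units_top G) W"
      "x0 \<in> W" "W \<subseteq> V"
    using compact_open_neighbourhood[OF locally_compact_units Hausdorff_units
      totally_disconnected_units, of V x0] by blast
  have WN: "y \<in> N i" if "i < n" "y \<in> W" for i y using W(4) that by (auto simp: V_def)
  define A where "A i = {g \<in> U i. src G g \<in> W}" for i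
  define h where "h = (\<Sum>i\<in>I. (\<lambda>g. if g \<in> A i then c i else 0))"
  have h_eq: "h g = (if src G g \<in> W then \<Sum>i\<in>{i\<in>I. g \<in> U i}. c i else 0)" for g
    unfolding h_def sum_fun_apply using finI by (simp add: A_def sum.inter_filter)
  have vanish: "h g = 0" if "f g = 0" for g
  proof (cases "src G g \<in> W")
    case True
    let ?S = "{i\<in>I. g \<in> U i}"
    have "f g = (\<Sum>i\<in>?S. \<phi> i g)"
      unfolding f_eq
    proof (rule sum.mono_neutral_right)
      show "\<forall>i\<in>{..<n} - ?S. \<phi> i g = 0"
        using N(5) WN True \<phi>_off by blast
    qed (auto simp: I_def)
    then have "cmod (sum c ?S) = cmod (\<Sum>i\<in>?S. \<phi> i g - c i)"
      using that by (simp add: sum_subtractf)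
    also have "\<dots> \<le> (\<Sum>i\<in>?S. \<epsilon>)"
      using N(4) WN True by (intro sum_norm_le) (auto simp: I_def intro!: less_imp_le)
    also have "\<dots> \<le> real n * \<epsilon>"
    proof -
      have "card ?S \<le> card {..<n}" by (rule card_mono) (auto simp: I_def)
      then show ?thesis using \<epsilon>(1) by (simp add: mult_right_mono)
    qed
    finally have "sum c ?S = 0" using \<delta>(2)[of ?S] \<epsilon>(2) by auto
    then show ?thesis using h_eq True by simp
  qed (simp add: h_eq)
  \<comment> \<open>If \<open>U i\<close> contains \<open>g0\<close>, then \<open>g0\<close> is its
    only point over \<open>x0\<close>, so \<open>p i\<close> is \<open>g0\<close> and freezing
    changes nothing there.\<close>
  have "h g0 = f g0"
  proof -
    have "h g0 = (\<Sum>i\<in>{i\<in>I. g0 \<in> U i}. \<phi> i g0)"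
    proof -
      have "p i = g0" if "i \<in> I" "g0 \<in> U i" for i
        using open_bisection_unique[OF U, of i "p i" g0] p that by (simp add: I_def x0_def)
      then have "c i = \<phi> i g0" if "i \<in> I" "g0 \<in> U i" for i
        using that by (simp add: c_def)
      then show ?thesis using W(3) by (simp add: h_eq x0_def[symmetric])
    qed
    also have "\<dots> = f g0"
      unfolding f_eq
    proof (rule sum.mono_neutral_left)
      show "\<forall>i\<in>{..<n} - {i\<in>I. g0 \<in> U i}. \<phi> i g0 = 0"
        using \<phi>_off unfolding I_def x0_def by blast
    qed (auto simp: I_def)
    finally show ?thesis .
  qed
  then have "h \<noteq> 0" using g0 by auto
  have "h \<in> steinberg_algebra G"
    unfolding h_def steinberg_algebra_def
  proof (intro fun_module.span_sum fun_module.span_base)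
    fix i assume i: "i \<in> I"
    then have "i < n" by (simp add: I_def)
    then have "W \<subseteq> src G ` U i" using N(3)[OF i] WN by blast
    then have "open_bisection G (A i)" "compactin (gtop G) (A i)"
      using open_bisection_restrict_src[OF U[OF \<open>i < n\<close>] W(1,2)]
      by (simp_all add: A_def)
    then show "(\<lambda>g. if g \<in> A i then c i else 0) \<in>
        {(\<lambda>g. if g \<in> U then c else 0) | c U. open_bisection G U \<and> compactin (gtop G) U}"
      by blast
  qed
  moreover have "gtop G interior_of (supp_open h) = {}"
  proof -
    \<comment> \<open>Openness of the source map makes this image an open subset of a set with empty
      interior.\<close>
    have "src G ` (gtop G interior_of (supp_open h)) \<subseteq> src G ` supp_open f"
      using interior_of_subset[of "gtop G" "supp_open h"] vanish by (auto simp: supp_open_def)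
    moreover have "openin (units_top G) (src G ` (gtop G interior_of (supp_open h)))"
      using open_map_src by (simp add: open_map_def)
    ultimately show ?thesis using empty interior_of_maximal by (metis image_is_empty subset_empty)
  qed
  ultimately show thesis using that \<open>h \<noteq> 0\<close> by (simp add: steinberg_singular_ideal_def)
qed

end

section \<open>Equivalence of the two vanishing conditions\<close>

theorem corollary4p6:
  fixes G :: "'g groupoid"
  assumes "ample_groupoid G"
    and "\<not> Hausdorff_space (gtop G)"
  shows "singular_ideal G \<inter> regular_rep G ` Cc G = {0} \<longleftrightarrow> steinberg_singular_ideal G = {0}"
proof -
  interpret ample_groupoid G by fact
  \<comment> \<open>Without arrows the space would be empty and thus Hausdorff.\<close>
  have units: "units G \<noteq> {}"
    using assms(2) by (auto simp: units_def Hausdorff_space_def)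
  have zero: "0 \<in> Cc G" "0 \<in> steinberg_algebra G"
    unfolding Cc_def steinberg_algebra_def by (rule fun_module.span_zero)+
  have as_fun: "as_function G (regular_rep G f) = f" if "f \<in> Cc G" for f
    using as_function_regular_rep Cc_off_arrows[OF that] by blast
  show ?thesis
  proof
    assume L: "singular_ideal G \<inter> regular_rep G ` Cc G = {0}"
    have "f = 0" if f: "f \<in> steinberg_singular_ideal G" for f
    proof -
      have fS: "f \<in> steinberg_algebra G" and fC: "f \<in> Cc G"
        using f steinberg_subset_Cc by (auto simp: steinberg_singular_ideal_def)
      \<comment> \<open>The function \<open>f\<close> serves as its own approximation in
        \<open>Cc G\<close>, so membership in the reduced algebra comes down to boundedness.\<close>
      have "family_norm G (regular_rep G f - regular_rep G f) = 0"
        using family_norm_zero[OF units] by simp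
      then have "regular_rep G f \<in> reduced_algebra G"
        using steinberg_regular_rep_bounded[OF fS] fC by (force simp: reduced_algebra_def)
      then have "regular_rep G f \<in> singular_ideal G"
        using f steinberg_src_support_interior[OF fS] as_fun[OF fC]
        by (simp add: singular_ideal_def steinberg_singular_ideal_def)
      then have "regular_rep G f = 0" using L fC by blast
      \<comment> \<open>Applying \<open>as_function\<close> recovers \<open>f\<close> from its
        operators, which gives injectivity of \<open>regular_rep G\<close> on
        \<open>Cc G\<close>.\<close>
      then show "f = 0"
        using as_fun[OF fC] as_fun[OF zero(1)] regular_rep_zero by metis
    qed
    moreover have "0 \<in> steinberg_singular_ideal G"
      using zero by (simp add: steinberg_singular_ideal_def supp_open_def)
    ultimately show "steinberg_singular_ideal G = {0}" by blast
  next
    assume R: "steinberg_singular_ideal G = {0}"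
    have "T = 0" if T: "T \<in> singular_ideal G" "T \<in> regular_rep G ` Cc G" for T
    proof -
      obtain f where f: "f \<in> Cc G" "T = regular_rep G f" using T(2) by blast
      have "units_top G interior_of (src G ` supp_open f) = {}"
        using T(1) f as_fun by (simp add: singular_ideal_def)
      then have "f = 0" using Cc_singular_imp_steinberg_singular[OF f(1)] R by blast
      then show "T = 0" using f(2) regular_rep_zero by simp
    qed
    moreover have "0 \<in> singular_ideal G" by (rule zero_in_singular_ideal[OF units])
    moreover have "0 \<in> regular_rep G ` Cc G" using zero(1) regular_rep_zero by (metis image_eqI)
    ultimately show "singular_ideal G \<inter> regular_rep G ` Cc G = {0}" by blast
  qed
qed

end
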